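(* In the downlink NOMA model of the context, with $a_m>\varepsilon_m a_n$, substituting the asymptotic connection outage probabilities $P^\infty_{m,CD}$ and $P^\infty_{m,PD}$ of the $m$-th user given in the context into the definition of diversity order shows that the diversity orders of the $m$-th user for CD-NOMA and PD-NOMA are $mK$ and $m$, respectively.
   Context: Downlink NOMA in a single cell: a base station (BS) at the centre of a disc of radius $R_D$ serves $M$ users whose locations form a homogeneous binomial point process in the disc (independent, uniformly distributed points). The data streams are mapped onto $K$ subcarriers by a sparse spreading matrix $\mathbf G$ of size $K\times M$, $M>K$, with few non-zero entries; its column for user $\varphi$ is $\mathbf g_\varphi=[g_{\varphi1},\dots,g_{\varphi K}]^T$, where $g_{\varphi k}=1$ or $0$ according to whether the signal is mapped onto subcarrier $k$ or not. The case $K\ne1$ is called CD-NOMA and $K=1$ PD-NOMA. The channel vector of user $\varphi$ is $\mathbf h_\varphi=[\tilde h_{\varphi1},\dots,\tilde h_{\varphi K}]^T$ with $\tilde h_{\varphi k}=\sqrt{\eta}\,h_{\varphi k}/\sqrt{1+d^\alpha}$, where $h_{\varphi k}\sim\mathcal{CN}(0,1)$ are independent (Rayleigh fading), $d$ is the distance from the BS to the user, $\eta>0$ is the frequency dependent factor and $\alpha>0$ the path loss exponent. Users are ordered so that $\|\mathbf h_M\|_2^2>\dots>\|\mathbf h_n\|_2^2>\dots>\|\mathbf h_m\|_2^2>\dots>\|\mathbf h_1\|_2^2$. Users $m$ and $n$ ($m<n$) are paired, with fixed power allocation coefficients $a_m>a_n$, $a_m+a_n=1$; $\mathbf g_m$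 and $\mathbf g_n$ are assumed to have the same column weights. $\rho$ is the transmit SNR. With maximal ratio combining, the SINR of the $m$-th user decoding its own signal is $$\gamma_m=\frac{\rho\,\|\mathrm{diag}(\mathbf h_m)\mathbf g_m\|_2^2\,a_m}{\rho\,\|\mathrm{diag}(\mathbf h_m)\mathbf g_n\|_2^2\,a_n+1},$$ and its connection outage probability (COP) is $\Pr(\gamma_m<\varepsilon_m)$ with $\varepsilon_m=2^{R_m}-1$, $R_m$ being the target rate of the $m$-th user. The diversity order is $d=-\lim_{\rho\to\infty}\frac{\log P^\infty(\rho)}{\log\rho}$, where $P^\infty(\rho)$ denotes the asymptotic COP. The asymptotic COP of the $m$-th user at high SNR is, for CD-NOMA and for PD-NOMA respectively, $$P_{m,CD}^\infty\approx\frac{M!}{(M-m)!\,m!}\left[\sum_{u=1}^U\frac{b_u}{K!}\left(\frac{\tau c_u}{\eta}\right)^K\right]^m\propto\frac1{\rho^{mK}},\qquad P_{m,PD}^\infty\approx\frac{M!}{(M-m)!\,m!}\left[\sum_{u=1}^U b_u\left(\frac{\tau c_u}{\eta}\right)\right]^m\propto\frac1{\rho^{m}},$$ with $\tau=\frac{\varepsilon_m}{\rho(a_m-\varepsilon_m a_n)}$, $\theta_u=\cos\left(\frac{2u-1}{2U}\pi\right)$, $b_u=\frac{\pi}{2U}\sqrt{1-\theta_u^2}\,(\theta_u+1)$, $c_u=1+\left(\frac{R_D}{2}(\theta_u+1)\right)^\alpha$, $U$ being a parameter (number of Gauss–Chebyshev terms) ensuring a complexity–accuracy tradeoff. *)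

theory Defs
  imports Complex_Main
begin

text \<open>
  The limit defining the diversity order is required to exist: a bare \<open>Lim\<close> term would
  have an unspecified value for a divergent quotient.
\<close>

definition has_diversity_order :: "(real \<Rightarrow> real) \<Rightarrow> real \<Rightarrow> bool" where
  "has_diversity_order P d \<longleftrightarrow>
     (\<exists>l. ((\<lambda>\<rho>. ln (P \<rho>) / ln \<rho>) \<longlongrightarrow> l) at_top \<and> d = - l)"

definition target_sinr :: "real \<Rightarrow> real" where
  "target_sinr R = 2 powr R - 1"

definition outage_threshold :: "real \<Rightarrow> real \<Rightarrow> real \<Rightarrow> real \<Rightarrow> real" where
  "outage_threshold \<epsilon> a_m a_n \<rho> = \<epsilon> / (\<rho> * (a_m - \<epsilon> * a_n))"

definition gc_node :: "nat \<Rightarrow> nat \<Rightarrow> real" where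
  "gc_node U u = cos ((2 * real u - 1) / (2 * real U) * pi)"

definition gc_weight :: "nat \<Rightarrow> nat \<Rightarrow> real" where
  "gc_weight U u = pi / (2 * real U) * sqrt (1 - (gc_node U u)\<^sup>2) * (gc_node U u + 1)"

text \<open>
  The user distance, uniform over the disc of radius \<open>R_D\<close>, is sampled at
  \<open>R_D / 2 * (gc_node U u + 1)\<close> by the Gauss--Chebyshev rule; this is the path loss there.
\<close>

definition gc_pathloss :: "real \<Rightarrow> real \<Rightarrow> nat \<Rightarrow> nat \<Rightarrow> real" where
  "gc_pathloss R_D \<alpha> U u = 1 + (R_D / 2 * (gc_node U u + 1)) powr \<alpha>"

text \<open>
  High-SNR asymptotic connection outage probability of the \<open>m\<close>-th weakest of \<open>M\<close> users,
  as a function of the transmit SNR \<open>\<rho>\<close>: \<open>K\<close> subcarriers (code domain) and a single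
  subcarrier (power domain).  The arguments \<open>\<eta>\<close>, \<open>\<alpha>\<close>, \<open>R_D\<close>, \<open>R_m\<close> are the frequency
  dependent factor, the path loss exponent, the cell radius and the target rate.
  The Gauss--Chebyshev approximation with \<open>U\<close> terms is part of the definition.
\<close>

definition asymp_COP_CD ::
  "nat \<Rightarrow> nat \<Rightarrow> nat \<Rightarrow> nat \<Rightarrow> real \<Rightarrow> real \<Rightarrow> real \<Rightarrow> real \<Rightarrow> real \<Rightarrow> real \<Rightarrow> real \<Rightarrow> real" where
  "asymp_COP_CD M K m U R_D \<alpha> \<eta> a_m a_n R_m \<rho> =
     fact M / (fact (M - m) * fact m) *
     (\<Sum>u = 1..U. gc_weight U u / fact K *
        (outage_threshold (target_sinr R_m) a_m a_n \<rho> * gc_pathloss R_D \<alpha> U u / \<eta>) ^ K) ^ m"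

definition asymp_COP_PD ::
  "nat \<Rightarrow> nat \<Rightarrow> nat \<Rightarrow> real \<Rightarrow> real \<Rightarrow> real \<Rightarrow> real \<Rightarrow> real \<Rightarrow> real \<Rightarrow> real \<Rightarrow> real" where
  "asymp_COP_PD M m U R_D \<alpha> \<eta> a_m a_n R_m \<rho> =
     fact M / (fact (M - m) * fact m) *
     (\<Sum>u = 1..U. gc_weight U u *
        (outage_threshold (target_sinr R_m) a_m a_n \<rho> * gc_pathloss R_D \<alpha> U u / \<eta>)) ^ m"

end

theory Submission
  imports Defs
begin

text \<open>
  All Gauss--Chebyshev weights are strictly positive, so each asymptotic outage probability
  is exactly \<open>C / \<rho> ^ N\<close> with \<open>C > 0\<close>, and \<open>ln (C / \<rho> ^ N) / ln \<rho> = ln C / ln \<rho> - N\<close>.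
\<close>

lemma has_diversity_order_power_law:
  assumes "C > 0" and P: "\<And>\<rho>. \<rho> > 1 \<Longrightarrow> P \<rho> = C / \<rho> ^ N"
  shows "has_diversity_order P (real N)"
proof -
  have "((\<lambda>\<rho>::real. ln C / ln \<rho> - real N) \<longlongrightarrow> 0 - real N) at_top"
    by (intro tendsto_diff tendsto_const real_tendsto_divide_at_top[OF tendsto_const] ln_at_top)
  \<comment> \<open>Beyond \<open>\<rho> = 1\<close> the denominator \<open>ln \<rho>\<close> is
    positive, so it cancels against \<open>real N * ln \<rho>\<close>.\<close>
  moreover have "\<forall>\<^sub>F \<rho> in at_top. ln C / ln \<rho> - real N = ln (P \<rho>) / ln \<rho>"
    using eventually_gt_at_top[of 1]
  proof eventually_elim
    case (elim \<rho>)
    then have "ln \<rho> > 0" by simp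
    moreover have "ln (P \<rho>) = ln C - real N * ln \<rho>"
      using elim \<open>C > 0\<close> by (simp add: P ln_div ln_realpow)
    ultimately show ?case
      by (simp add: diff_divide_distrib)
  qed
  ultimately have "((\<lambda>\<rho>. ln (P \<rho>) / ln \<rho>) \<longlongrightarrow> - real N) at_top"
    by (simp add: Lim_transform_eventually)
  then show ?thesis
    unfolding has_diversity_order_def by (intro exI[of _ "- real N"]) simp
qed

text \<open>From \<open>1 \<le> u\<close> and \<open>u \<le> U\<close> follows
  \<open>0 < 2 * u - 1 < 2 * U\<close>, so the angle lies strictly between 0 and \<open>pi\<close>,
  where the cosine decreases strictly from 1 to -1.\<close>

lemma gc_node_bounds:
  assumes "u \<in> {1..U}"
  shows "- 1 < gc_node U u" and "gc_node U u < 1"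
proof -
  define q where "q = (2 * real u - 1) / (2 * real U)"
  have "0 < q" "q < 1"
    using assms by (auto simp: q_def divide_simps)
  then have "0 < q * pi" "q * pi < pi"
    by auto
  then show "- 1 < gc_node U u" "gc_node U u < 1"
    using cos_monotone_0_pi[of "q * pi" pi] cos_monotone_0_pi[of 0 "q * pi"]
    by (auto simp: gc_node_def q_def)
qed

text \<open>The square root vanishes at nodes 1 and -1, the last factor at -1; the strict node
  bounds exclude both.\<close>

lemma gc_weight_pos:
  assumes "u \<in> {1..U}"
  shows "gc_weight U u > 0"
proof -
  have "(gc_node U u)\<^sup>2 < 1"
    using gc_node_bounds[OF assms] by (simp add: abs_square_less_1)
  then show ?thesis
    using gc_node_bounds(1)[OF assms] assms by (simp add: gc_weight_def)
qed

lemma gc_pathloss_pos: "gc_pathloss R_D \<alpha> U u > 0"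
  by (simp add: gc_pathloss_def add_pos_nonneg)

lemma target_sinr_pos: "R > 0 \<Longrightarrow> target_sinr R > 0"
  by (simp add: target_sinr_def)

text \<open>Reduces the power domain to the code domain, so that only one limit has to be
  computed.\<close>

lemma asymp_COP_PD_eq_CD: "asymp_COP_PD M m U = asymp_COP_CD M 1 m U"
  by (intro ext) (simp add: asymp_COP_PD_def asymp_COP_CD_def)

lemma has_diversity_order_asymp_COP_CD:
  assumes "1 \<le> U" and "\<eta> > 0" and "R_m > 0" and "a_m > target_sinr R_m * a_n"
  shows "has_diversity_order (asymp_COP_CD M K m U R_D \<alpha> \<eta> a_m a_n R_m) (real (m * K))"
proof -
  \<comment> \<open>\<open>t\<close> is the outage threshold at \<open>\<rho> = 1\<close>, and
    \<open>S\<close> is the bracketed sum there: the part left once all powers of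
    \<open>\<rho>\<close> are factored out.\<close>
  define t where "t = target_sinr R_m / (a_m - target_sinr R_m * a_n)"
  define S where
    "S = (\<Sum>u = 1..U. gc_weight U u / fact K * (t * gc_pathloss R_D \<alpha> U u / \<eta>) ^ K)"
  have "t > 0"
    using assms by (simp add: t_def target_sinr_pos)
  \<comment> \<open>Every summand is positive, and \<open>1 \<le> U\<close> makes the index set
    nonempty.\<close>
  then have "S > 0"
    unfolding S_def using assms
    by (intro sum_pos) (auto intro!: mult_pos_pos divide_pos_pos zero_less_power
          gc_weight_pos gc_pathloss_pos)
  show ?thesis
  proof (rule has_diversity_order_power_law)
    show "fact M / (fact (M - m) * fact m) * S ^ m > 0"
      using \<open>S > 0\<close> by simp
    fix \<rho> :: real
    have "outage_threshold (target_sinr R_m) a_m a_n \<rho> = t / \<rho>"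
      by (simp add: outage_threshold_def t_def)
    then have "(\<Sum>u = 1..U. gc_weight U u / fact K *
        (outage_threshold (target_sinr R_m) a_m a_n \<rho> * gc_pathloss R_D \<alpha> U u / \<eta>) ^ K)
      = S / \<rho> ^ K"
      unfolding S_def sum_divide_distrib
      by (intro sum.cong) (simp_all add: power_mult_distrib power_divide)
    \<comment> \<open>The outer power \<open>m\<close>, coming from the user order, multiplies the
      exponent \<open>K\<close> of the sum: this is the source of \<open>m * K\<close>.\<close>
    then show "asymp_COP_CD M K m U R_D \<alpha> \<eta> a_m a_n R_m \<rho>
      = fact M / (fact (M - m) * fact m) * S ^ m / \<rho> ^ (m * K)"
      by (simp add: asymp_COP_CD_def power_divide power_mult[symmetric] mult.commute)
  qed
qed

theorem mainTheorem4:
  fixes M K m n U :: nat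
    and R_D \<alpha> \<eta> a_m a_n R_m :: real
  assumes "1 \<le> K" and "K < M"
    and "1 \<le> m" and "m < n" and "n \<le> M"
    and "1 \<le> U"
    and "R_D > 0" and "\<alpha> > 0" and "\<eta> > 0"
    and "a_m > a_n" and "a_m + a_n = 1"
    and "R_m > 0"
    and "a_m > target_sinr R_m * a_n"
  shows "(K \<noteq> 1 \<longrightarrow>
            has_diversity_order (asymp_COP_CD M K m U R_D \<alpha> \<eta> a_m a_n R_m) (real (m * K)))
       \<and> (K = 1 \<longrightarrow>
            has_diversity_order (asymp_COP_PD M m U R_D \<alpha> \<eta> a_m a_n R_m) (real m))"
  \<comment> \<open>One instance serves both conjuncts: for \<open>K = 1\<close> it speaks of the
    rewritten \<open>asymp_COP_PD\<close>, and \<open>m * K\<close> becomes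
    \<open>m\<close>.\<close>
  using has_diversity_order_asymp_COP_CD[OF assms(6,9,12,13), of M K m R_D \<alpha>]
  by (auto simp: asymp_COP_PD_eq_CD)

end
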